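(* Let $(R,S)$ be a generalized Rota-Baxter system on an $A$-bimodule $M$ over an associative algebra $A$. A deformation $(R_t,S_t)$ of order $N$ of $(R,S)$ is extensible if and only if the obstruction class $[Ob_{(R_t,S_t)}]\in H^2(M,A)$ is trivial.
   Context: All vector spaces are over a field $\mathbb{K}$ of characteristic zero. A generalized Rota-Baxter system on an $A$-bimodule $M$ over $A$ is a pair of linear maps $R,S:M\to A$ with $R(u)R(v)=R(R(u)\cdot v+u\cdot S(v))$ and $S(u)S(v)=S(R(u)\cdot v+u\cdot S(v))$ for all $u,v\in M$. A deformation of order $N$ of $(R,S)$ consists of finite sums $R_t=\sum_{i=0}^Nt^iR_i$, $S_t=\sum_{i=0}^Nt^iS_i$ with $R_i,S_i\in\mathrm{Hom}(M,A)$, $R_0=R$, $S_0=S$, such that $(R_t,S_t)$ is a generalized Rota-Baxter system on $M[[t]]/(t^{N+1})$ over $A[[t]]/(t^{N+1})$ (structures extended $\mathbb{K}[[t]]/(t^{N+1})$-bilinearly). It is extensible if there is a pair $(R_{N+1},S_{N+1})$ of linear maps $M\to A$ such that $(R_t+t^{N+1}R_{N+1},\,S_t+t^{N+1}S_{N+1})$ is a deformation of order $N+1$. Bracket: for $F=(F_1,F_2)\in\mathrm{Hom}(M^{\otimes m},A\oplus A)$ and $G=(G_1,G_2)\in\mathrm{Hom}(M^{\otimes n},A\oplus A)$, $m,n\ge0$, $\llbracket F,G\rrbracket\in\mathrm{Hom}(M^{\otimes(m+n)},A\oplus A)$ has components, $k=1,2$, \begin{align*} \llbracket F,G\rrbracket_k(u_1,\dots,u_{m+n})=&\sum_{i=1}^m(-1)^{(i-1)n}F_k(u_1,\dots,u_{i-1},G_1(u_i,\dots,u_{i+n-1})\cdot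 u_{i+n},\dots,u_{m+n})\\ &-\sum_{i=1}^m(-1)^{in}F_k(u_1,\dots,u_{i-1},u_i\cdot G_2(u_{i+1},\dots,u_{i+n}),u_{i+n+1},\dots,u_{m+n})\\ &-(-1)^{mn}\Big\{\sum_{i=1}^n(-1)^{(i-1)m}G_k(u_1,\dots,u_{i-1},F_1(u_i,\dots,u_{i+m-1})\cdot u_{i+m},\dots,u_{m+n})\\ &\qquad-\sum_{i=1}^n(-1)^{im}G_k(u_1,\dots,u_{i-1},u_i\cdot F_2(u_{i+1},\dots,u_{i+m}),u_{i+m+1},\dots,u_{m+n})\Big\}\\ &+(-1)^{mn}\big[F_k(u_1,\dots,u_m)G_k(u_{m+1},\dots,u_{m+n})-(-1)^{mn}G_k(u_1,\dots,u_n)F_k(u_{n+1},\dots,u_{m+n})\big]. \end{align*} The cohomology $H^\bullet(M,A)$ of $(R,S)$ is that of $C^n(M,A)=\mathrm{Hom}(M^{\otimes n},A\oplus A)$, $n\ge0$, with differential $d_{(R,S)}=\llbracket(R,S),\cdot\rrbracket$. The obstruction of an order $N$ deformation is $Ob_{(R_t,S_t)}=-\frac12\sum_{i+j=N+1,\,i,j\ge1}\llbracket(R_i,S_i),(R_j,S_j)\rrbracket$; it is a $2$-cocycle for $d_{(R,S)}$, and $[Ob_{(R_t,S_t)}]\in H^2(M,A)$ denotes its class. *)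

theory Defs
  imports Complex_Main "HOL-Library.Function_Algebras" "HOL-Library.Product_Plus"
begin

text \<open>
  The associative algebra $A$ is a type of class \<^class>\<open>ring\<close> (no unit is required), the bimodule
  $M$ is a type of class \<^class>\<open>ab_group_add\<close>; \<open>lact a u\<close> is $a \cdot u$ and \<open>ract u a\<close> is
  $u \cdot a$.
\<close>

locale algebra_bimodule =
  A: vector_space sA + M: vector_space sM
  for sA :: "'k::field_char_0 \<Rightarrow> 'a::ring \<Rightarrow> 'a"
    and sM :: "'k \<Rightarrow> 'm::ab_group_add \<Rightarrow> 'm" +
  fixes lact :: "'a \<Rightarrow> 'm \<Rightarrow> 'm"
    and ract :: "'m \<Rightarrow> 'a \<Rightarrow> 'm"
  assumes mult_linear_right: "Vector_Spaces.linear sA sA (\<lambda>b. a * b)"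
    and mult_linear_left: "Vector_Spaces.linear sA sA (\<lambda>a. a * b)"
    and lact_linear_right: "Vector_Spaces.linear sM sM (\<lambda>u. lact a u)"
    and lact_linear_left: "Vector_Spaces.linear sA sM (\<lambda>a. lact a u)"
    and ract_linear_right: "Vector_Spaces.linear sA sM (\<lambda>a. ract u a)"
    and ract_linear_left: "Vector_Spaces.linear sM sM (\<lambda>u. ract u a)"
    and lact_mult: "lact (a * b) u = lact a (lact b u)"
    and ract_mult: "ract u (a * b) = ract (ract u a) b"
    and lact_ract: "ract (lact a u) b = lact a (ract u b)"


subsection \<open>Generalized Rota-Baxter systems\<close>

text \<open>
  The scalars, the algebra and the bimodule are given here by carrier sets \<open>KC\<close>, \<open>AC\<close>, \<open>MC\<close> with
  operations, because the notion is needed over $K$ as well as over $K[[t]]/(t^{N+1})$.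
\<close>

definition linear_map_on ::
  "'k set \<Rightarrow> ('k \<Rightarrow> 'm \<Rightarrow> 'm) \<Rightarrow> ('k \<Rightarrow> 'a \<Rightarrow> 'a) \<Rightarrow> 'm set \<Rightarrow> 'a set \<Rightarrow>
    ('m::plus \<Rightarrow> 'a::plus) \<Rightarrow> bool"
where
  "linear_map_on KC sM sA MC AC f \<longleftrightarrow>
     (\<forall>u\<in>MC. f u \<in> AC) \<and>
     (\<forall>u\<in>MC. \<forall>v\<in>MC. f (u + v) = f u + f v) \<and>
     (\<forall>c\<in>KC. \<forall>u\<in>MC. f (sM c u) = sA c (f u))"

definition gen_rota_baxter_on ::
  "'k set \<Rightarrow> ('k \<Rightarrow> 'a \<Rightarrow> 'a) \<Rightarrow> ('k \<Rightarrow> 'm \<Rightarrow> 'm) \<Rightarrow> 'a set \<Rightarrow> 'm set \<Rightarrow>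
    ('a \<Rightarrow> 'a \<Rightarrow> 'a) \<Rightarrow> ('a \<Rightarrow> 'm \<Rightarrow> 'm) \<Rightarrow> ('m \<Rightarrow> 'a \<Rightarrow> 'm) \<Rightarrow>
    ('m::plus \<Rightarrow> 'a::plus) \<Rightarrow> ('m \<Rightarrow> 'a) \<Rightarrow> bool"
where
  "gen_rota_baxter_on KC sA sM AC MC mult lact ract R S \<longleftrightarrow>
     linear_map_on KC sM sA MC AC R \<and> linear_map_on KC sM sA MC AC S \<and>
     (\<forall>u\<in>MC. \<forall>v\<in>MC.
        mult (R u) (R v) = R (lact (R u) v + ract u (S v)) \<and>
        mult (S u) (S v) = S (lact (R u) v + ract u (S v)))"

definition gen_rota_baxter ::
  "('k \<Rightarrow> 'a \<Rightarrow> 'a) \<Rightarrow> ('k \<Rightarrow> 'm \<Rightarrow> 'm) \<Rightarrow> ('a \<Rightarrow> 'm \<Rightarrow> 'm) \<Rightarrow> ('m \<Rightarrow> 'a \<Rightarrow> 'm) \<Rightarrow>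
    ('m::ab_group_add \<Rightarrow> 'a::ring) \<Rightarrow> ('m \<Rightarrow> 'a) \<Rightarrow> bool"
where
  "gen_rota_baxter sA sM lact ract R S \<longleftrightarrow>
     gen_rota_baxter_on UNIV sA sM UNIV UNIV (*) lact ract R S"


subsection \<open>Deformations\<close>

text \<open>
  An element of $X[[t]]/(t^{N+1})$ is represented by its coefficients, that is, by a sequence that
  vanishes beyond \<open>N\<close>.  A biadditive map \<open>f\<close> on coefficients extends by the Cauchy product modulo
  $t^{N+1}$.  A sequence of maps \<open>F 0\<close>, \<dots>, \<open>F N\<close> acts as $\sum_i t^i F_i$ through the same extension
  of the evaluation map.
\<close>

definition trunc_series :: "nat \<Rightarrow> (nat \<Rightarrow> 'x::zero) set" where
  "trunc_series N = {u. \<forall>n>N. u n = 0}"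

definition trunc_ext ::
  "nat \<Rightarrow> ('x \<Rightarrow> 'y \<Rightarrow> 'z::comm_monoid_add) \<Rightarrow> (nat \<Rightarrow> 'x) \<Rightarrow> (nat \<Rightarrow> 'y) \<Rightarrow> (nat \<Rightarrow> 'z)"
where
  "trunc_ext N f u v = (\<lambda>n. if n \<le> N then (\<Sum>i\<le>n. f (u i) (v (n - i))) else 0)"

definition trunc_map ::
  "nat \<Rightarrow> (nat \<Rightarrow> 'x \<Rightarrow> 'y::comm_monoid_add) \<Rightarrow> (nat \<Rightarrow> 'x) \<Rightarrow> (nat \<Rightarrow> 'y)"
where
  "trunc_map N F = trunc_ext N (\<lambda>f x. f x) F"

text \<open>Only the entries with index at most \<open>N\<close> of \<open>Rs\<close> and \<open>Ss\<close> matter.\<close>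

definition deformation ::
  "('k::field \<Rightarrow> 'a \<Rightarrow> 'a) \<Rightarrow> ('k \<Rightarrow> 'm \<Rightarrow> 'm) \<Rightarrow> ('a \<Rightarrow> 'm \<Rightarrow> 'm) \<Rightarrow> ('m \<Rightarrow> 'a \<Rightarrow> 'm) \<Rightarrow>
    ('m \<Rightarrow> 'a) \<Rightarrow> ('m \<Rightarrow> 'a) \<Rightarrow> nat \<Rightarrow>
    (nat \<Rightarrow> 'm::ab_group_add \<Rightarrow> 'a::ring) \<Rightarrow> (nat \<Rightarrow> 'm \<Rightarrow> 'a) \<Rightarrow> bool"
where
  "deformation sA sM lact ract R S N Rs Ss \<longleftrightarrow>
     (\<forall>i\<le>N. Vector_Spaces.linear sM sA (Rs i) \<and>
             Vector_Spaces.linear sM sA (Ss i)) \<and>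
     Rs 0 = R \<and> Ss 0 = S \<and>
     gen_rota_baxter_on (trunc_series N) (trunc_ext N sA) (trunc_ext N sM)
       (trunc_series N) (trunc_series N)
       (trunc_ext N (*)) (trunc_ext N lact) (trunc_ext N ract)
       (trunc_map N Rs) (trunc_map N Ss)"

definition extensible ::
  "('k::field \<Rightarrow> 'a \<Rightarrow> 'a) \<Rightarrow> ('k \<Rightarrow> 'm \<Rightarrow> 'm) \<Rightarrow> ('a \<Rightarrow> 'm \<Rightarrow> 'm) \<Rightarrow> ('m \<Rightarrow> 'a \<Rightarrow> 'm) \<Rightarrow>
    ('m \<Rightarrow> 'a) \<Rightarrow> ('m \<Rightarrow> 'a) \<Rightarrow> nat \<Rightarrow>
    (nat \<Rightarrow> 'm::ab_group_add \<Rightarrow> 'a::ring) \<Rightarrow> (nat \<Rightarrow> 'm \<Rightarrow> 'a) \<Rightarrow> bool"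
where
  "extensible sA sM lact ract R S N Rs Ss \<longleftrightarrow>
     (\<exists>R' S'. Vector_Spaces.linear sM sA R' \<and> Vector_Spaces.linear sM sA S' \<and>
        deformation sA sM lact ract R S (N + 1) (Rs(N + 1 := R')) (Ss(N + 1 := S')))"


subsection \<open>Cochains and the bracket\<close>

text \<open>
  An element of $\mathrm{Hom}(M^{\otimes n}, A \oplus A)$ is a function on lists that is linear in each
  entry of lists of length \<open>n\<close> and, so that equality of functions is equality of cochains, zero on
  lists of any other length.
\<close>

definition scale_pair :: "('k \<Rightarrow> 'a \<Rightarrow> 'a) \<Rightarrow> 'k \<Rightarrow> 'a \<times> 'a \<Rightarrow> 'a \<times> 'a" where
  "scale_pair sA c = map_prod (sA c) (sA c)"

definition cochains ::
  "('k::field \<Rightarrow> 'a \<Rightarrow> 'a) \<Rightarrow> ('k \<Rightarrow> 'm \<Rightarrow> 'm) \<Rightarrow> nat \<Rightarrow>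
    ('m::ab_group_add list \<Rightarrow> 'a::ab_group_add \<times> 'a) set"
where
  "cochains sA sM n =
     {F. (\<forall>us. length us \<noteq> n \<longrightarrow> F us = 0) \<and>
         (\<forall>xs ys. length xs + 1 + length ys = n \<longrightarrow>
            Vector_Spaces.linear sM (scale_pair sA) (\<lambda>u. F (xs @ [u] @ ys)))}"

definition pair_cochain :: "('m \<Rightarrow> 'a) \<Rightarrow> ('m \<Rightarrow> 'a) \<Rightarrow> 'm list \<Rightarrow> 'a::zero \<times> 'a" where
  "pair_cochain R S us = (if length us = 1 then (R (hd us), S (hd us)) else 0)"

text \<open>
  Arguments are numbered from 1: \<open>arg us i\<close> is $u_i$ and \<open>args us i j\<close> is $u_i, \dots, u_j$ (empty
  for $j = i - 1$); only $i \ge 1$ occurs.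
\<close>

definition arg :: "'m list \<Rightarrow> nat \<Rightarrow> 'm" where
  "arg us i = us ! (i - 1)"

definition args :: "'m list \<Rightarrow> nat \<Rightarrow> nat \<Rightarrow> 'm list" where
  "args us i j = drop (i - 1) (take j us)"

definition insert_left ::
  "('k::comm_ring_1 \<Rightarrow> 'a \<Rightarrow> 'a) \<Rightarrow> ('a \<Rightarrow> 'm \<Rightarrow> 'm) \<Rightarrow>
    nat \<Rightarrow> ('m list \<Rightarrow> 'a) \<Rightarrow> nat \<Rightarrow> ('m list \<Rightarrow> 'a) \<Rightarrow> 'm list \<Rightarrow> 'a::ab_group_add"
where
  "insert_left sA lact m f n g us =
     (\<Sum>i=1..m. sA ((-1) ^ ((i - 1) * n))
        (f (args us 1 (i - 1) @ [lact (g (args us i (i + n - 1))) (arg us (i + n))]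
            @ args us (i + n + 1) (m + n))))"

definition insert_right ::
  "('k::comm_ring_1 \<Rightarrow> 'a \<Rightarrow> 'a) \<Rightarrow> ('m \<Rightarrow> 'a \<Rightarrow> 'm) \<Rightarrow>
    nat \<Rightarrow> ('m list \<Rightarrow> 'a) \<Rightarrow> nat \<Rightarrow> ('m list \<Rightarrow> 'a) \<Rightarrow> 'm list \<Rightarrow> 'a::ab_group_add"
where
  "insert_right sA ract m f n g us =
     (\<Sum>i=1..m. sA ((-1) ^ (i * n))
        (f (args us 1 (i - 1) @ [ract (arg us i) (g (args us (i + 1) (i + n)))]
            @ args us (i + n + 1) (m + n))))"

text \<open>\<open>pr\<close> is the projection of $A \oplus A$ to the component to be computed.\<close>

definition bracket_component ::
  "('k::comm_ring_1 \<Rightarrow> 'a \<Rightarrow> 'a) \<Rightarrow> ('a \<Rightarrow> 'm \<Rightarrow> 'm) \<Rightarrow> ('m \<Rightarrow> 'a \<Rightarrow> 'm) \<Rightarrow> ('a \<times> 'a \<Rightarrow> 'a) \<Rightarrow>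
    nat \<Rightarrow> ('m list \<Rightarrow> 'a \<times> 'a) \<Rightarrow> nat \<Rightarrow> ('m list \<Rightarrow> 'a \<times> 'a) \<Rightarrow> 'm list \<Rightarrow> 'a::ring"
where
  "bracket_component sA lact ract pr m F n G us =
     insert_left sA lact m (pr \<circ> F) n (fst \<circ> G) us
     - insert_right sA ract m (pr \<circ> F) n (snd \<circ> G) us
     - sA ((-1) ^ (m * n))
         (insert_left sA lact n (pr \<circ> G) m (fst \<circ> F) us
          - insert_right sA ract n (pr \<circ> G) m (snd \<circ> F) us)
     + sA ((-1) ^ (m * n))
         (pr (F (args us 1 m)) * pr (G (args us (m + 1) (m + n)))
          - sA ((-1) ^ (m * n)) (pr (G (args us 1 n)) * pr (F (args us (n + 1) (m + n)))))"

definition bracket ::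
  "('k::comm_ring_1 \<Rightarrow> 'a \<Rightarrow> 'a) \<Rightarrow> ('a \<Rightarrow> 'm \<Rightarrow> 'm) \<Rightarrow> ('m \<Rightarrow> 'a \<Rightarrow> 'm) \<Rightarrow>
    nat \<Rightarrow> ('m list \<Rightarrow> 'a \<times> 'a) \<Rightarrow> nat \<Rightarrow> ('m list \<Rightarrow> 'a \<times> 'a) \<Rightarrow> 'm list \<Rightarrow> 'a::ring \<times> 'a"
where
  "bracket sA lact ract m F n G us =
     (if length us = m + n
      then (bracket_component sA lact ract fst m F n G us,
            bracket_component sA lact ract snd m F n G us)
      else 0)"


subsection \<open>Cohomology and the obstruction class\<close>

definition differential ::
  "('k::comm_ring_1 \<Rightarrow> 'a \<Rightarrow> 'a) \<Rightarrow> ('a \<Rightarrow> 'm \<Rightarrow> 'm) \<Rightarrow> ('m \<Rightarrow> 'a \<Rightarrow> 'm) \<Rightarrow>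
    ('m \<Rightarrow> 'a) \<Rightarrow> ('m \<Rightarrow> 'a) \<Rightarrow> nat \<Rightarrow> ('m list \<Rightarrow> 'a \<times> 'a) \<Rightarrow> 'm list \<Rightarrow> 'a::ring \<times> 'a"
where
  "differential sA lact ract R S n F = bracket sA lact ract 1 (pair_cochain R S) n F"

definition cocycles ::
  "('k::field \<Rightarrow> 'a \<Rightarrow> 'a) \<Rightarrow> ('k \<Rightarrow> 'm \<Rightarrow> 'm) \<Rightarrow> ('a \<Rightarrow> 'm \<Rightarrow> 'm) \<Rightarrow> ('m \<Rightarrow> 'a \<Rightarrow> 'm) \<Rightarrow>
    ('m \<Rightarrow> 'a) \<Rightarrow> ('m \<Rightarrow> 'a) \<Rightarrow> nat \<Rightarrow> ('m::ab_group_add list \<Rightarrow> 'a::ring \<times> 'a) set"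
where
  "cocycles sA sM lact ract R S n =
     {F \<in> cochains sA sM n. differential sA lact ract R S n F = 0}"

definition coboundaries ::
  "('k::field \<Rightarrow> 'a \<Rightarrow> 'a) \<Rightarrow> ('k \<Rightarrow> 'm \<Rightarrow> 'm) \<Rightarrow> ('a \<Rightarrow> 'm \<Rightarrow> 'm) \<Rightarrow> ('m \<Rightarrow> 'a \<Rightarrow> 'm) \<Rightarrow>
    ('m \<Rightarrow> 'a) \<Rightarrow> ('m \<Rightarrow> 'a) \<Rightarrow> nat \<Rightarrow> ('m::ab_group_add list \<Rightarrow> 'a::ring \<times> 'a) set"
where
  "coboundaries sA sM lact ract R S n =
     (if n = 0 then {0} else differential sA lact ract R S (n - 1) ` cochains sA sM (n - 1))"

definition cohomologous ::
  "('k::field \<Rightarrow> 'a \<Rightarrow> 'a) \<Rightarrow> ('k \<Rightarrow> 'm \<Rightarrow> 'm) \<Rightarrow> ('a \<Rightarrow> 'm \<Rightarrow> 'm) \<Rightarrow> ('m \<Rightarrow> 'a \<Rightarrow> 'm) \<Rightarrow>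
    ('m \<Rightarrow> 'a) \<Rightarrow> ('m \<Rightarrow> 'a) \<Rightarrow> nat \<Rightarrow> ('m::ab_group_add list \<Rightarrow> 'a::ring \<times> 'a) rel"
where
  "cohomologous sA sM lact ract R S n =
     {(F, G). F \<in> cocycles sA sM lact ract R S n \<and> G \<in> cocycles sA sM lact ract R S n \<and>
              F - G \<in> coboundaries sA sM lact ract R S n}"

definition cohomology ::
  "('k::field \<Rightarrow> 'a \<Rightarrow> 'a) \<Rightarrow> ('k \<Rightarrow> 'm \<Rightarrow> 'm) \<Rightarrow> ('a \<Rightarrow> 'm \<Rightarrow> 'm) \<Rightarrow> ('m \<Rightarrow> 'a \<Rightarrow> 'm) \<Rightarrow>
    ('m \<Rightarrow> 'a) \<Rightarrow> ('m \<Rightarrow> 'a) \<Rightarrow> nat \<Rightarrow> ('m::ab_group_add list \<Rightarrow> 'a::ring \<times> 'a) set set"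
where
  "cohomology sA sM lact ract R S n =
     cocycles sA sM lact ract R S n // cohomologous sA sM lact ract R S n"

definition cohomology_class ::
  "('k::field \<Rightarrow> 'a \<Rightarrow> 'a) \<Rightarrow> ('k \<Rightarrow> 'm \<Rightarrow> 'm) \<Rightarrow> ('a \<Rightarrow> 'm \<Rightarrow> 'm) \<Rightarrow> ('m \<Rightarrow> 'a \<Rightarrow> 'm) \<Rightarrow>
    ('m \<Rightarrow> 'a) \<Rightarrow> ('m \<Rightarrow> 'a) \<Rightarrow> nat \<Rightarrow>
    ('m::ab_group_add list \<Rightarrow> 'a::ring \<times> 'a) \<Rightarrow> ('m list \<Rightarrow> 'a \<times> 'a) set"
where
  "cohomology_class sA sM lact ract R S n F = cohomologous sA sM lact ract R S n `` {F}"

lemma cohomology_class_in_cohomology: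
  "F \<in> cocycles sA sM lact ract R S n \<Longrightarrow>
     cohomology_class sA sM lact ract R S n F \<in> cohomology sA sM lact ract R S n"
  unfolding cohomology_def cohomology_class_def by (rule quotientI)

definition obstruction ::
  "('k::field \<Rightarrow> 'a \<Rightarrow> 'a) \<Rightarrow> ('a \<Rightarrow> 'm \<Rightarrow> 'm) \<Rightarrow> ('m \<Rightarrow> 'a \<Rightarrow> 'm) \<Rightarrow> nat \<Rightarrow>
    (nat \<Rightarrow> 'm \<Rightarrow> 'a) \<Rightarrow> (nat \<Rightarrow> 'm \<Rightarrow> 'a) \<Rightarrow> 'm list \<Rightarrow> 'a::ring \<times> 'a"
where
  "obstruction sA lact ract N Rs Ss us =
     scale_pair sA (- 1 / 2)
       (\<Sum>(i, j) \<in> {(i, j). i + j = N + 1 \<and> 1 \<le> i \<and> 1 \<le> j}.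
          bracket sA lact ract 1 (pair_cochain (Rs i) (Ss i)) 1 (pair_cochain (Rs j) (Ss j)) us)"

end

theory Submission
  imports Defs
begin

text \<open>
  Comparing coefficients, $(R_t, S_t)$ is a generalized Rota-Baxter system modulo $t^{n+1}$ iff
  $\sum_{i+j=m} [[(R_i, S_i), (R_j, S_j)]] = 0$ for all $m \le n$.  For an order $N$ deformation the
  only new equation for an extension is the one for $m = N + 1$.  Its terms with $i = 0$ or $j = 0$
  add up to $2\,d(R_{N+1}, S_{N+1})$ and the others to $-2\,Ob$, so extensions correspond to
  1-cochains with differential $Ob$.  That $Ob$ is then a cocycle follows from $d \circ d = 0$ on
  1-cochains, so no separate computation of $d(Ob)$ is needed.
\<close>

section \<open>Linearity rules and brackets in low degree\<close>

lemmas linear_map_add = module_hom.add[OF Vector_Spaces.linear.axioms(3)]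
  and linear_map_diff = module_hom.diff[OF Vector_Spaces.linear.axioms(3)]
  and linear_map_zero = module_hom.zero[OF Vector_Spaces.linear.axioms(3)]
  and linear_map_sum = module_hom.sum[OF Vector_Spaces.linear.axioms(3)]
  and linear_map_scale = module_hom.scale[OF Vector_Spaces.linear.axioms(3)]

context algebra_bimodule
begin

lemmas bilinear_simps =
  linear_map_add[OF lact_linear_right] linear_map_add[OF lact_linear_left]
  linear_map_add[OF ract_linear_right] linear_map_add[OF ract_linear_left]
  linear_map_diff[OF lact_linear_right] linear_map_diff[OF lact_linear_left]
  linear_map_diff[OF ract_linear_right] linear_map_diff[OF ract_linear_left]
  linear_map_zero[OF lact_linear_right] linear_map_zero[OF lact_linear_left]
  linear_map_zero[OF ract_linear_right] linear_map_zero[OF ract_linear_left]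

lemmas bilinear_scale =
  linear_map_scale[OF lact_linear_right] linear_map_scale[OF lact_linear_left]
  linear_map_scale[OF ract_linear_right] linear_map_scale[OF ract_linear_left]
  linear_map_scale[OF mult_linear_right] linear_map_scale[OF mult_linear_left]

lemmas bilinear_sum =
  linear_map_sum[OF lact_linear_right] linear_map_sum[OF lact_linear_left]
  linear_map_sum[OF ract_linear_right] linear_map_sum[OF ract_linear_left]

text \<open>For \<open>G1 = F1\<close>, \<open>G2 = F2\<close> additive, this is twice the defect of
  the two generalized Rota-Baxter identities; in this way the bracket encodes them.\<close>

lemma bracket_one_one:
  "bracket sA lact ract 1 (pair_cochain F1 F2) 1 (pair_cochain G1 G2) [u, v] =
    (F1 (lact (G1 u) v) + F1 (ract u (G2 v)) + G1 (lact (F1 u) v) + G1 (ract u (F2 v))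
       - F1 u * G1 v - G1 u * F1 v,
     F2 (lact (G1 u) v) + F2 (ract u (G2 v)) + G2 (lact (F1 u) v) + G2 (ract u (F2 v))
       - F2 u * G2 v - G2 u * F2 v)"
  by (simp add: bracket_def bracket_component_def insert_left_def insert_right_def
      args_def arg_def pair_cochain_def numeral_2_eq_2)

text \<open>Together with \<open>bracket_one_one\<close> this makes the double differential of a
  1-cochain an explicit expression in three arguments.\<close>

lemma bracket_one_two:
  "bracket sA lact ract 1 (pair_cochain P Q) 2 G [u, v, w] =
    (P (lact (fst (G [u, v])) w) - P (ract u (snd (G [v, w])))
       - fst (G [lact (P u) v, w]) + fst (G [u, lact (P v) w])
       - fst (G [ract u (Q v), w]) + fst (G [u, ract v (Q w)])
       + P u * fst (G [v, w]) - fst (G [u, v]) * P w,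
     Q (lact (fst (G [u, v])) w) - Q (ract u (snd (G [v, w])))
       - snd (G [lact (P u) v, w]) + snd (G [u, lact (P v) w])
       - snd (G [ract u (Q v), w]) + snd (G [u, ract v (Q w)])
       + Q u * snd (G [v, w]) - snd (G [u, v]) * Q w)"
  by (simp add: bracket_def bracket_component_def insert_left_def insert_right_def
      args_def arg_def pair_cochain_def numeral_2_eq_2 algebra_simps)

end

section \<open>Reindexing triple sums of coefficients\<close>

text \<open>The left side is the shape of the $t^n$ coefficient of a product $F_t(u) F_t(v)$, sorted
  by the degree \<open>i\<close> of the first factor. The right side fixes the positions
  \<open>p\<close>, \<open>q\<close> of the coefficients of u and v first, so that the innermost sum
  belongs to a single equation of degree \<open>n - p - q\<close>.\<close>

lemma sum_series_mult:
  fixes f :: "nat \<Rightarrow> nat \<Rightarrow> nat \<Rightarrow> nat \<Rightarrow> 'b::comm_monoid_add"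
  shows "(\<Sum>i\<le>n. \<Sum>j\<le>i. \<Sum>k\<le>n-i. f j (i - j) k (n - i - k)) =
    (\<Sum>p\<le>n. \<Sum>q\<le>n-p. \<Sum>j\<le>n-p-q. f j p (n - p - q - j) q)"
proof -
  have "(\<Sum>i\<le>n. \<Sum>j\<le>i. \<Sum>k\<le>n-i. f j (i - j) k (n - i - k)) =
    (\<Sum>(i,j,k)\<in>(SIGMA i:{..n}. {..i} \<times> {..n-i}). f j (i - j) k (n - i - k))"
    by (simp add: sum.Sigma sum.cartesian_product)
  also have "\<dots> = (\<Sum>(p,q,j)\<in>(SIGMA p:{..n}. SIGMA q:{..n-p}. {..n-p-q}). f j p (n - p - q - j) q)"
    by (rule sum.reindex_bij_witness[where i = "\<lambda>(p,q,j). (p + j, j, n-p-q-j)"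
          and j = "\<lambda>(i,j,k). (i-j, n-i-k, j)"]) auto
  finally show ?thesis by (simp add: sum.Sigma)
qed

text \<open>The analogue for a map applied to an action $G_t(u) v$. The arguments of
  \<open>f\<close> are the index of the outer map, the index of the inner map, and the positions of
  u and v. The right side has the same normal form as for the product.\<close>

lemma sum_series_map_left:
  fixes f :: "nat \<Rightarrow> nat \<Rightarrow> nat \<Rightarrow> nat \<Rightarrow> 'b::comm_monoid_add"
  shows "(\<Sum>i\<le>n. \<Sum>j\<le>n-i. \<Sum>k\<le>j. f i k (j - k) (n - i - j)) =
    (\<Sum>p\<le>n. \<Sum>q\<le>n-p. \<Sum>i\<le>n-p-q. f i (n - p - q - i) p q)"
proof -
  have "(\<Sum>i\<le>n. \<Sum>j\<le>n-i. \<Sum>k\<le>j. f i k (j - k) (n - i - j)) =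
    (\<Sum>(i,j,k)\<in>(SIGMA i:{..n}. SIGMA j:{..n-i}. {..j}). f i k (j - k) (n - i - j))"
    by (simp add: sum.Sigma)
  also have "\<dots> = (\<Sum>(p,q,i)\<in>(SIGMA p:{..n}. SIGMA q:{..n-p}. {..n-p-q}). f i (n - p - q - i) p q)"
    by (rule sum.reindex_bij_witness[where i = "\<lambda>(p,q,i). (i, n-i-q, n-p-q-i)"
          and j = "\<lambda>(i,j,k). (j-k, n-i-j, i)"]) auto
  finally show ?thesis by (simp add: sum.Sigma)
qed

lemma sum_series_map_right:
  fixes f :: "nat \<Rightarrow> nat \<Rightarrow> nat \<Rightarrow> nat \<Rightarrow> 'b::comm_monoid_add"
  shows "(\<Sum>i\<le>n. \<Sum>j\<le>n-i. \<Sum>k\<le>n-i-j. f i k j (n - i - j - k)) =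
    (\<Sum>p\<le>n. \<Sum>q\<le>n-p. \<Sum>i\<le>n-p-q. f i (n - p - q - i) p q)"
proof -
  have "(\<Sum>i\<le>n. \<Sum>j\<le>n-i. \<Sum>k\<le>n-i-j. f i k j (n - i - j - k)) =
    (\<Sum>(i,j,k)\<in>(SIGMA i:{..n}. SIGMA j:{..n-i}. {..n-i-j}). f i k j (n - i - j - k))"
    by (simp add: sum.Sigma)
  also have "\<dots> = (\<Sum>(p,q,i)\<in>(SIGMA p:{..n}. SIGMA q:{..n-p}. {..n-p-q}). f i (n - p - q - i) p q)"
    by (rule sum.reindex_bij_witness[where i = "\<lambda>(p,q,i). (i, p, n-p-q-i)"
          and j = "\<lambda>(i,j,k). (j, n-i-j-k, i)"]) auto
  finally show ?thesis by (simp add: sum.Sigma)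
qed

section \<open>Coefficients of the truncated identities\<close>

definition const_series :: "'x \<Rightarrow> nat \<Rightarrow> 'x::zero" where
  "const_series x = (\<lambda>i. if i = 0 then x else 0)"

lemma const_series_in_trunc_series: "const_series x \<in> trunc_series N"
  by (simp add: const_series_def trunc_series_def)

lemma trunc_ext_in_trunc_series: "trunc_ext N f u v \<in> trunc_series N"
  by (simp add: trunc_series_def trunc_ext_def)

lemma trunc_map_const:
  assumes "\<And>i. i \<le> N \<Longrightarrow> F i 0 = 0"
  shows "trunc_map N F (const_series x) = (\<lambda>n. if n \<le> N then F n x else 0)"
proof
  fix n
  show "trunc_map N F (const_series x) n = (if n \<le> N then F n x else 0)"
  proof (cases "n \<le> N")
    case True
    \<comment> \<open>Only \<open>i = n\<close> meets the nonzero coefficient of the constant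
      series; the other summands are \<open>F i 0\<close>.\<close>
    have "(\<Sum>i\<le>n. F i (if n - i = 0 then x else 0)) = (\<Sum>i\<le>n. if i = n then F n x else 0)"
      using True assms by (intro sum.cong) auto
    then show ?thesis using True by (simp add: trunc_map_def trunc_ext_def const_series_def)
  qed (simp add: trunc_map_def trunc_ext_def)
qed

text \<open>For scalars, linearity of each \<open>F i\<close> turns both sides into sums over one
  map index and one scalar index, and it remains to exchange the two.\<close>

lemma linear_map_on_trunc_map:
  assumes lin: "\<And>i. i \<le> N \<Longrightarrow> Vector_Spaces.linear sM sA (F i)"
  shows "linear_map_on KC (trunc_ext N sM) (trunc_ext N sA)
    (trunc_series N) (trunc_series N) (trunc_map N F)"
  unfolding linear_map_on_def
proof (intro conjI ballI)
  fix u v :: "nat \<Rightarrow> 'b"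
  show "trunc_map N F u \<in> trunc_series N"
    by (simp add: trunc_map_def trunc_ext_in_trunc_series)
  show "trunc_map N F (u + v) = trunc_map N F u + trunc_map N F v"
    by (auto simp: trunc_map_def trunc_ext_def fun_eq_iff sum.distrib[symmetric]
        linear_map_add[OF lin] intro!: sum.cong)
  fix c :: "nat \<Rightarrow> 'a"
  show "trunc_map N F (trunc_ext N sM c u) = trunc_ext N sA c (trunc_map N F u)"
  proof
    fix n
    show "trunc_map N F (trunc_ext N sM c u) n = trunc_ext N sA c (trunc_map N F u) n"
    proof (cases "n \<le> N")
      case True
      \<comment> \<open>Index 0 is always at most \<open>N\<close>, so \<open>F 0\<close> is a
        linear map at hand that brings the vector space laws of the target into scope as
        \<open>vs2\<close>.\<close>
      interpret Vector_Spaces.linear sM sA "F 0" using lin by simp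
      have "(\<Sum>i\<le>n. F i (\<Sum>j\<le>n-i. sM (c j) (u (n - i - j)))) =
          (\<Sum>i\<le>n. \<Sum>j\<le>n-i. sA (c j) (F i (u (n - i - j))))"
        using True by (intro sum.cong) (simp_all add: linear_map_sum[OF lin] linear_map_scale[OF lin])
      also have "\<dots> = (\<Sum>(i,j)\<in>(SIGMA i:{..n}. {..n-i}). sA (c j) (F i (u (n - i - j))))"
        by (simp add: sum.Sigma)
      also have "\<dots> = (\<Sum>(j,i)\<in>(SIGMA j:{..n}. {..n-j}). sA (c j) (F i (u (n - j - i))))"
        by (rule sum.reindex_bij_witness[where i = "\<lambda>(i,j). (j,i)" and j = "\<lambda>(i,j). (j,i)"])
          (auto simp: diff_diff_left add.commute)
      also have "\<dots> = (\<Sum>j\<le>n. sA (c j) (\<Sum>i\<le>n-j. F i (u (n - j - i))))"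
        by (simp add: sum.Sigma vs2.scale_sum_right)
      finally show ?thesis
        using True by (simp add: trunc_map_def trunc_ext_def le_trans[OF diff_le_self True])
    qed (simp add: trunc_map_def trunc_ext_def)
  qed
qed

lemma trunc_mult_coeff:
  fixes F :: "nat \<Rightarrow> 'x \<Rightarrow> 'y::ring"
  assumes "n \<le> N"
  shows "trunc_ext N (*) (trunc_map N F u) (trunc_map N F v) n =
    (\<Sum>p\<le>n. \<Sum>q\<le>n-p. \<Sum>i\<le>n-p-q. F i (u p) * F (n - p - q - i) (v q))"
proof -
  have "trunc_ext N (*) (trunc_map N F u) (trunc_map N F v) n =
      (\<Sum>i\<le>n. \<Sum>j\<le>i. \<Sum>k\<le>n-i. F j (u (i - j)) * F k (v (n - i - k)))"
    using assms by (auto simp: trunc_ext_def trunc_map_def sum_product intro!: sum.cong)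
  also have "\<dots> = (\<Sum>p\<le>n. \<Sum>q\<le>n-p. \<Sum>i\<le>n-p-q. F i (u p) * F (n - p - q - i) (v q))"
    by (rule sum_series_mult)
  finally show ?thesis .
qed

lemma trunc_mult_const:
  fixes F :: "nat \<Rightarrow> 'x::zero \<Rightarrow> 'y::ring"
  assumes "n \<le> N" "\<And>i. i \<le> N \<Longrightarrow> F i 0 = 0"
  shows "trunc_ext N (*) (trunc_map N F (const_series u)) (trunc_map N F (const_series v)) n =
      (\<Sum>i\<le>n. F i u * F (n - i) v)"
  using assms by (auto simp: trunc_map_const trunc_ext_def intro!: sum.cong)

context algebra_bimodule
begin

text \<open>Linearity moves \<open>F i\<close> and the two actions through all sums; the left and
  right action parts then become triple sums with the same normal form and can be merged.\<close>

lemma trunc_map_action_coeff: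
  assumes "n \<le> N" and lin: "\<And>i. i \<le> N \<Longrightarrow> Vector_Spaces.linear sM sA (F i)"
  shows "trunc_map N F (trunc_ext N lact (trunc_map N G u) v + trunc_ext N ract u (trunc_map N H v)) n =
    (\<Sum>p\<le>n. \<Sum>q\<le>n-p. \<Sum>i\<le>n-p-q.
       F i (lact (G (n - p - q - i) (u p)) (v q) + ract (u p) (H (n - p - q - i) (v q))))"
proof -
  have "trunc_map N F (trunc_ext N lact (trunc_map N G u) v + trunc_ext N ract u (trunc_map N H v)) n =
      (\<Sum>i\<le>n. \<Sum>j\<le>n-i. \<Sum>k\<le>j. F i (lact (G k (u (j - k))) (v (n - i - j)))) +
      (\<Sum>i\<le>n. \<Sum>j\<le>n-i. \<Sum>k\<le>n-i-j. F i (ract (u j) (H k (v (n - i - j - k)))))"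
    using assms(1)
    by (auto simp: trunc_ext_def trunc_map_def le_trans[OF diff_le_self assms(1)]
        linear_map_add[OF lin] linear_map_sum[OF lin] bilinear_sum
        sum.distrib[symmetric] intro!: sum.cong arg_cong2[where f = "(+)"])
  also have "\<dots> = (\<Sum>p\<le>n. \<Sum>q\<le>n-p. \<Sum>i\<le>n-p-q. F i (lact (G (n - p - q - i) (u p)) (v q))) +
      (\<Sum>p\<le>n. \<Sum>q\<le>n-p. \<Sum>i\<le>n-p-q. F i (ract (u p) (H (n - p - q - i) (v q))))"
    by (rule arg_cong2[where f = "(+)"],
        rule sum_series_map_left[where f = "\<lambda>i k p q. F i (lact (G k (u p)) (v q))"],
        rule sum_series_map_right[where f = "\<lambda>i k p q. F i (ract (u p) (H k (v q)))"])
  also have "\<dots> = (\<Sum>p\<le>n. \<Sum>q\<le>n-p. \<Sum>i\<le>n-p-q.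
       F i (lact (G (n - p - q - i) (u p)) (v q) + ract (u p) (H (n - p - q - i) (v q))))"
    using assms(1) by (auto simp: linear_map_add[OF lin] sum.distrib[symmetric] intro!: sum.cong)
  finally show ?thesis .
qed

text \<open>The $t^n$ coefficient of the two identities for $(R_t, S_t)$ at constant arguments u, v.
  It involves only the entries of index at most \<open>n\<close>.\<close>

definition rota_baxter_coeff where
  "rota_baxter_coeff (n::nat) Rs Ss \<longleftrightarrow> (\<forall>u v.
     (\<Sum>i\<le>n. Rs i u * Rs (n - i) v) =
       (\<Sum>i\<le>n. Rs i (lact (Rs (n - i) u) v + ract u (Ss (n - i) v))) \<and>
     (\<Sum>i\<le>n. Ss i u * Ss (n - i) v) =
       (\<Sum>i\<le>n. Ss i (lact (Rs (n - i) u) v + ract u (Ss (n - i) v))))"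

lemma rota_baxter_coeff_cong:
  assumes "\<And>i. i \<le> n \<Longrightarrow> Rs i = Rs' i" "\<And>i. i \<le> n \<Longrightarrow> Ss i = Ss' i"
  shows "rota_baxter_coeff n Rs Ss \<longleftrightarrow> rota_baxter_coeff n Rs' Ss'"
  by (simp add: rota_baxter_coeff_def assms)

lemma trunc_map_action_const:
  assumes "n \<le> N" and lin: "\<And>i. i \<le> N \<Longrightarrow> Vector_Spaces.linear sM sA (F i)"
    "\<And>i. i \<le> N \<Longrightarrow> Vector_Spaces.linear sM sA (G i)"
    "\<And>i. i \<le> N \<Longrightarrow> Vector_Spaces.linear sM sA (H i)"
  shows "trunc_map N F (trunc_ext N lact (trunc_map N G (const_series u)) (const_series v) +
        trunc_ext N ract (const_series u) (trunc_map N H (const_series v))) n =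
      (\<Sum>i\<le>n. F i (lact (G (n - i) u) v + ract u (H (n - i) v)))"
proof -
  have z: "F i 0 = 0" "G i 0 = 0" "H i 0 = 0" if "i \<le> N" for i
    using lin that by (auto intro: linear_map_zero)
  \<comment> \<open>A constant series has its only possibly nonzero coefficient at 0, so just
    \<open>p = 0\<close> and then \<open>q = 0\<close> survive.\<close>
  have "(\<Sum>q\<le>n - p. \<Sum>i\<le>n - p - q. F i (lact (G (n - p - q - i) (const_series u p)) (const_series v q) +
      ract (const_series u p) (H (n - p - q - i) (const_series v q)))) = (if p = 0 then
      (\<Sum>i\<le>n. F i (lact (G (n - i) u) v + ract u (H (n - i) v))) else 0)" if "p \<le> n" for p
  proof (cases "p = 0")
    case True
    have "(\<Sum>i\<le>n - q. F i (lact (G (n - q - i) u) (const_series v q) + ract u (H (n - q - i) (const_series v q)))) =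
       (if q = 0 then (\<Sum>i\<le>n. F i (lact (G (n - i) u) v + ract u (H (n - i) v))) else 0)"
      if "q \<le> n" for q
      using assms(1) that by (auto simp: const_series_def z bilinear_simps)
    then show ?thesis using True by (simp add: const_series_def)
  next
    case False
    then show ?thesis using assms(1) by (simp add: const_series_def z bilinear_simps)
  qed
  then show "trunc_map N F (trunc_ext N lact (trunc_map N G (const_series u)) (const_series v) +
        trunc_ext N ract (const_series u) (trunc_map N H (const_series v))) n =
      (\<Sum>i\<le>n. F i (lact (G (n - i) u) v + ract u (H (n - i) v)))"
    using assms(1) by (simp add: trunc_map_action_coeff lin)
qed

text \<open>Constant series extract the coefficient equations. Conversely, the $t^n$ coefficient at
  arbitrary series u, v is the sum over \<open>p\<close> and \<open>q\<close> of the equations of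
  degree \<open>n - p - q\<close> at \<open>u p\<close> and \<open>v q\<close>.\<close>

lemma gen_rota_baxter_on_trunc_iff:
  assumes R: "\<And>i. i \<le> N \<Longrightarrow> Vector_Spaces.linear sM sA (Rs i)"
    and S: "\<And>i. i \<le> N \<Longrightarrow> Vector_Spaces.linear sM sA (Ss i)"
  shows "gen_rota_baxter_on (trunc_series N) (trunc_ext N sA) (trunc_ext N sM)
       (trunc_series N) (trunc_series N)
       (trunc_ext N (*)) (trunc_ext N lact) (trunc_ext N ract)
       (trunc_map N Rs) (trunc_map N Ss) \<longleftrightarrow> (\<forall>n\<le>N. rota_baxter_coeff n Rs Ss)"
    (is "?L \<longleftrightarrow> ?R")
proof
  assume L: ?L
  show ?R
    unfolding rota_baxter_coeff_def
  proof (intro allI impI)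
    fix n u v assume n: "n \<le> N"
    let ?w = "trunc_ext N lact (trunc_map N Rs (const_series u)) (const_series v) +
        trunc_ext N ract (const_series u) (trunc_map N Ss (const_series v))"
    have "trunc_ext N (*) (trunc_map N Rs (const_series u)) (trunc_map N Rs (const_series v)) n =
        trunc_map N Rs ?w n"
      "trunc_ext N (*) (trunc_map N Ss (const_series u)) (trunc_map N Ss (const_series v)) n =
        trunc_map N Ss ?w n"
      using L const_series_in_trunc_series[of u N] const_series_in_trunc_series[of v N]
      unfolding gen_rota_baxter_on_def by metis+
    then show "(\<Sum>i\<le>n. Rs i u * Rs (n - i) v) =
         (\<Sum>i\<le>n. Rs i (lact (Rs (n - i) u) v + ract u (Ss (n - i) v))) \<and>
       (\<Sum>i\<le>n. Ss i u * Ss (n - i) v) =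
         (\<Sum>i\<le>n. Ss i (lact (Rs (n - i) u) v + ract u (Ss (n - i) v)))"
      by (simp add: trunc_mult_const trunc_map_action_const n R S
          linear_map_zero[OF R] linear_map_zero[OF S])
  qed
next
  assume ?R
  then have coeff: "(\<Sum>i\<le>m. Rs i u * Rs (m - i) v) =
         (\<Sum>i\<le>m. Rs i (lact (Rs (m - i) u) v + ract u (Ss (m - i) v)))"
       "(\<Sum>i\<le>m. Ss i u * Ss (m - i) v) =
         (\<Sum>i\<le>m. Ss i (lact (Rs (m - i) u) v + ract u (Ss (m - i) v)))" if "m \<le> N" for m u v
    using that unfolding rota_baxter_coeff_def by blast+
  have "trunc_ext N (*) (trunc_map N Rs u) (trunc_map N Rs v) n =
        trunc_map N Rs (trunc_ext N lact (trunc_map N Rs u) v + trunc_ext N ract u (trunc_map N Ss v)) n \<and>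
     trunc_ext N (*) (trunc_map N Ss u) (trunc_map N Ss v) n =
        trunc_map N Ss (trunc_ext N lact (trunc_map N Rs u) v + trunc_ext N ract u (trunc_map N Ss v)) n"
    for u v n
  proof (cases "n \<le> N")
    case True
    then show ?thesis
      \<comment> \<open>\<open>coeff\<close> is applied with \<open>m = n - p - q\<close>; without
        \<open>diff_diff_left\<close> these differences keep the shape that matches it.\<close>
      by (simp add: trunc_mult_coeff trunc_map_action_coeff R S coeff le_trans[OF diff_le_self]
          del: diff_diff_left)
  qed (simp add: trunc_ext_def trunc_map_def)
  then show ?L
    unfolding gen_rota_baxter_on_def
    by (intro conjI ballI ext linear_map_on_trunc_map R S) blast+
qed

section \<open>Cochains of degree one and two\<close>

lemma vector_space_scale_pair: "vector_space (scale_pair sA)"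
  by unfold_locales
    (auto simp: scale_pair_def A.scale_right_distrib A.scale_left_distrib)

lemma linear_scale_pair_iff:
  "Vector_Spaces.linear sM (scale_pair sA) f \<longleftrightarrow>
    Vector_Spaces.linear sM sA (\<lambda>u. fst (f u)) \<and> Vector_Spaces.linear sM sA (\<lambda>u. snd (f u))"
  using vector_space_scale_pair
  by (auto simp: Vector_Spaces.linear_iff prod_eq_iff scale_pair_def A.vector_space_axioms
      M.vector_space_axioms)

lemma pair_cochain_in_cochains:
  assumes "Vector_Spaces.linear sM sA X" "Vector_Spaces.linear sM sA Y"
  shows "pair_cochain X Y \<in> cochains sA sM 1"
  using assms by (simp add: cochains_def pair_cochain_def linear_scale_pair_iff)

text \<open>Converse of \<open>pair_cochain_in_cochains\<close>. Equality holds on lists of every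
  length because cochains of degree 1 vanish off length 1.\<close>

lemma cochain_one_cases:
  assumes "F \<in> cochains sA sM 1"
  obtains X Y where "F = pair_cochain X Y"
    "Vector_Spaces.linear sM sA X" "Vector_Spaces.linear sM sA Y"
proof
  have "\<forall>xs ys. length xs + 1 + length ys = 1 \<longrightarrow>
      Vector_Spaces.linear sM (scale_pair sA) (\<lambda>u. F (xs @ [u] @ ys))"
    using assms unfolding cochains_def by blast
  from this[rule_format, of "[]" "[]"] show "Vector_Spaces.linear sM sA (\<lambda>u. fst (F [u]))"
    "Vector_Spaces.linear sM sA (\<lambda>u. snd (F [u]))"
    by (simp_all add: linear_scale_pair_iff)
  have "F us = pair_cochain (\<lambda>u. fst (F [u])) (\<lambda>u. snd (F [u])) us" for us
    using assms by (cases us) (auto simp: pair_cochain_def cochains_def)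
  then show "F = pair_cochain (\<lambda>u. fst (F [u])) (\<lambda>u. snd (F [u]))" by blast
qed

text \<open>With \<open>(R, S)\<close> as first argument this shows that coboundaries of degree 2
  are cochains, as the inclusion into the cocycles requires.\<close>

lemma bracket_one_one_in_cochains:
  assumes "Vector_Spaces.linear sM sA F1" "Vector_Spaces.linear sM sA F2"
    "Vector_Spaces.linear sM sA G1" "Vector_Spaces.linear sM sA G2"
  shows "bracket sA lact ract 1 (pair_cochain F1 F2) 1 (pair_cochain G1 G2) \<in> cochains sA sM 2"
proof -
  note simps = Vector_Spaces.linear_iff M.vector_space_axioms A.vector_space_axioms
    linear_map_add[OF assms(1)] linear_map_add[OF assms(2)]
    linear_map_add[OF assms(3)] linear_map_add[OF assms(4)]
    linear_map_scale[OF assms(1)] linear_map_scale[OF assms(2)]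
    linear_map_scale[OF assms(3)] linear_map_scale[OF assms(4)]
    bilinear_simps bilinear_scale A.scale_right_distrib A.scale_right_diff_distrib algebra_simps
  have "Vector_Spaces.linear sM (scale_pair sA)
      (\<lambda>u. bracket sA lact ract 1 (pair_cochain F1 F2) 1 (pair_cochain G1 G2) [u, v])"
    "Vector_Spaces.linear sM (scale_pair sA)
      (\<lambda>u. bracket sA lact ract 1 (pair_cochain F1 F2) 1 (pair_cochain G1 G2) [v, u])" for v
    unfolding bracket_one_one linear_scale_pair_iff fst_conv snd_conv by (simp_all add: simps)
  \<comment> \<open>A list of length 2 has the distinguished entry \<open>u\<close> either first or
    second.\<close>
  then have "Vector_Spaces.linear sM (scale_pair sA)
      (\<lambda>u. bracket sA lact ract 1 (pair_cochain F1 F2) 1 (pair_cochain G1 G2) (xs @ [u] @ ys))"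
    if "length xs + 1 + length ys = 2" for xs ys
    using that by (cases xs; cases ys) auto
  then show ?thesis
    unfolding cochains_def by (simp add: bracket_def)
qed

text \<open>Checked by expansion on three arguments instead of a graded Jacobi identity: the
  Rota-Baxter identities, additivity, and the associativity laws of the algebra and bimodule cancel
  all terms.\<close>

lemma differential_differential_one:
  assumes "gen_rota_baxter sA sM lact ract R S"
    and lin: "Vector_Spaces.linear sM sA X" "Vector_Spaces.linear sM sA Y"
  shows "differential sA lact ract R S 2 (differential sA lact ract R S 1 (pair_cochain X Y)) = 0"
proof
  fix us
  have add: "R (u + v) = R u + R v" "S (u + v) = S u + S v"
    and rb: "R (lact (R u) v + ract u (S v)) = R u * R v"
      "S (lact (R u) v + ract u (S v)) = S u * S v" for u v
    using assms(1) by (simp_all add: gen_rota_baxter_def gen_rota_baxter_on_def linear_map_on_def)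
  have diff: "R (u - v) = R u - R v" "S (u - v) = S u - S v" for u v
    using add[of "u - v" v] by simp_all
  \<comment> \<open>oriented so that they rewrite every 3-argument expression to a normal form\<close>
  have rb': "R (lact (R u) v) = R u * R v - R (ract u (S v))"
    "S (lact (R u) v) = S u * S v - S (ract u (S v))" for u v
    using rb[of u v] by (simp_all add: add algebra_simps)
  show "differential sA lact ract R S 2
      (differential sA lact ract R S 1 (pair_cochain X Y)) us = 0 us"
  proof (cases "length us = 3")
    case True
    then obtain u v w where "us = [u, v, w]"
      by (auto simp: length_Suc_conv numeral_3_eq_3)
    then show ?thesis
      unfolding differential_def
      by (simp only: bracket_one_two bracket_one_one fst_conv snd_conv)
        (simp add: add diff rb' bilinear_simps linear_map_add[OF lin(1)] linear_map_add[OF lin(2)]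
          linear_map_diff[OF lin(1)] linear_map_diff[OF lin(2)] lact_mult ract_mult lact_ract
          zero_prod_def algebra_simps)
  next
    case False
    then show ?thesis by (simp add: differential_def bracket_def)
  qed
qed

section \<open>Bracket equations and the new equation of an extension\<close>

text \<open>Characteristic zero makes the scalar 2 cancellable, which removes the factor 2 from
  bracket equations.\<close>

lemma double_eq_iff:
  fixes x y :: "'a \<times> 'a"
  shows "x + x = y + y \<longleftrightarrow> x = y"
proof
  assume h: "x + x = y + y"
  have *: "a = b" if "a + a = b + b" for a b :: 'a
  proof -
    have "sA 2 a = sA 2 b"
      using that A.scale_left_distrib[of 1 1 a] A.scale_left_distrib[of 1 1 b] by simp
    then show ?thesis by (simp add: A.scale_cancel_left)
  qed
  show "x = y"
    using h by (auto simp: prod_eq_iff intro: *)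
qed simp

text \<open>Each bracket contains every term once with outer index \<open>i\<close> and once with
  outer index \<open>n - i\<close>. Reversing the sum identifies the two, so the total is twice the
  difference between the two sides of the coefficient equation.\<close>

lemma rota_baxter_coeff_iff_bracket:
  fixes n :: nat
  assumes R: "\<And>i. i \<le> n \<Longrightarrow> Vector_Spaces.linear sM sA (Rs i)"
    and S: "\<And>i. i \<le> n \<Longrightarrow> Vector_Spaces.linear sM sA (Ss i)"
  shows "rota_baxter_coeff n Rs Ss \<longleftrightarrow>
    (\<forall>u v. (\<Sum>i\<le>n. bracket sA lact ract 1 (pair_cochain (Rs i) (Ss i))
       1 (pair_cochain (Rs (n - i)) (Ss (n - i))) [u, v]) = 0)"
proof -
  have flip: "(\<Sum>i\<le>n. f (n - i) i) = (\<Sum>i\<le>n. f i (n - i))"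
    for f :: "nat \<Rightarrow> nat \<Rightarrow> 'a"
    by (rule sum.reindex_bij_witness[where i = "\<lambda>i. n - i" and j = "\<lambda>i. n - i"]) auto
  have "(\<Sum>i\<le>n. bracket sA lact ract 1 (pair_cochain (Rs i) (Ss i))
       1 (pair_cochain (Rs (n - i)) (Ss (n - i))) [u, v]) =
     (\<Sum>i\<le>n. (Rs i (lact (Rs (n - i) u) v + ract u (Ss (n - i) v)),
               Ss i (lact (Rs (n - i) u) v + ract u (Ss (n - i) v)))) +
     (\<Sum>i\<le>n. (Rs i (lact (Rs (n - i) u) v + ract u (Ss (n - i) v)),
               Ss i (lact (Rs (n - i) u) v + ract u (Ss (n - i) v)))) -
     ((\<Sum>i\<le>n. (Rs i u * Rs (n - i) v, Ss i u * Ss (n - i) v)) +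
      (\<Sum>i\<le>n. (Rs i u * Rs (n - i) v, Ss i u * Ss (n - i) v)))" for u v
    unfolding bracket_one_one
    using flip[of "\<lambda>i j. Rs i (lact (Rs j u) v)"] flip[of "\<lambda>i j. Rs i (ract u (Ss j v))"]
      flip[of "\<lambda>i j. Ss i (lact (Rs j u) v)"] flip[of "\<lambda>i j. Ss i (ract u (Ss j v))"]
      flip[of "\<lambda>i j. Rs i u * Rs j v"] flip[of "\<lambda>i j. Ss i u * Ss j v"]
    by (simp add: prod_eq_iff fst_sum snd_sum sum.distrib sum_subtractf
        linear_map_add[OF R] linear_map_add[OF S])
  then show ?thesis
    unfolding rota_baxter_coeff_def
    by (simp only: right_minus_eq double_eq_iff) (auto simp: prod_eq_iff fst_sum snd_sum)
qed

text \<open>An update at \<open>N + 1\<close> leaves the equations of degree at most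
  \<open>N\<close> unchanged, and these hold by assumption.\<close>

lemma deformation_extend_iff:
  assumes "deformation sA sM lact ract R S N Rs Ss"
    and "Vector_Spaces.linear sM sA R'" "Vector_Spaces.linear sM sA S'"
  shows "deformation sA sM lact ract R S (N + 1) (Rs(N + 1 := R')) (Ss(N + 1 := S')) \<longleftrightarrow>
    rota_baxter_coeff (N + 1) (Rs(N + 1 := R')) (Ss(N + 1 := S'))"
proof -
  let ?R = "Rs(N + 1 := R')" and ?S = "Ss(N + 1 := S')"
  have lin: "Vector_Spaces.linear sM sA (Rs i)" "Vector_Spaces.linear sM sA (Ss i)" if "i \<le> N" for i
    using assms(1) that by (auto simp: deformation_def)
  have "rota_baxter_coeff n Rs Ss" if "n \<le> N" for n
    using assms(1) that gen_rota_baxter_on_trunc_iff[of N Rs Ss] lin by (auto simp: deformation_def)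
  then have "rota_baxter_coeff n ?R ?S" if "n \<le> N" for n
    using that rota_baxter_coeff_cong[of n ?R Rs ?S Ss] by simp
  moreover have "Vector_Spaces.linear sM sA (?R i)" "Vector_Spaces.linear sM sA (?S i)"
    if "i \<le> N + 1" for i
    using that lin assms(2,3) by (auto simp: le_Suc_eq)
  moreover have "Rs 0 = R" "Ss 0 = S" using assms(1) by (auto simp: deformation_def)
  ultimately show ?thesis
    unfolding deformation_def
    by (subst gen_rota_baxter_on_trunc_iff) (auto simp: le_Suc_eq)
qed

lemma bracket_sym_one_one:
  "bracket sA lact ract 1 (pair_cochain F1 F2) 1 (pair_cochain G1 G2) [u, v] =
   bracket sA lact ract 1 (pair_cochain G1 G2) 1 (pair_cochain F1 F2) [u, v]"
  by (simp only: bracket_one_one) (simp add: algebra_simps)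

lemma rota_baxter_coeff_extend_iff:
  assumes "deformation sA sM lact ract R S N Rs Ss"
    and "Vector_Spaces.linear sM sA R'" "Vector_Spaces.linear sM sA S'"
  shows "rota_baxter_coeff (N + 1) (Rs(N + 1 := R')) (Ss(N + 1 := S')) \<longleftrightarrow>
    differential sA lact ract R S 1 (pair_cochain R' S') = obstruction sA lact ract N Rs Ss"
proof -
  let ?R = "Rs(N + 1 := R')" and ?S = "Ss(N + 1 := S')"
  let ?d = "differential sA lact ract R S 1 (pair_cochain R' S')"
  let ?Ob = "obstruction sA lact ract N Rs Ss"
  have lin: "Vector_Spaces.linear sM sA (?R i)" "Vector_Spaces.linear sM sA (?S i)"
    if "i \<le> N + 1" for i
    using assms that by (auto simp: deformation_def le_Suc_eq)
  have zero: "Rs 0 = R" "Ss 0 = S" using assms(1) by (auto simp: deformation_def)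
  \<comment> \<open>Doubling clears the factor -1/2 and allows a comparison with the sum of
    brackets.\<close>
  have Ob2: "?Ob us + ?Ob us = - (\<Sum>i=1..N. bracket sA lact ract 1 (pair_cochain (Rs i) (Ss i))
      1 (pair_cochain (Rs (N + 1 - i)) (Ss (N + 1 - i))) us)" for us
  proof -
    have "sA (- 1 / 2) a + sA (- 1 / 2) a = - a" for a
      by (simp only: A.scale_left_distrib[symmetric]) simp
    then have half: "scale_pair sA (- 1 / 2) x + scale_pair sA (- 1 / 2) x = - x" for x
      by (simp only: scale_pair_def prod_eq_iff) simp
    \<comment> \<open>A pair of positive indices with sum \<open>N + 1\<close> is determined by its
      first entry, which ranges over \<open>1..N\<close>.\<close>
    have "(\<Sum>(i, j) \<in> {(i, j). i + j = N + 1 \<and> 1 \<le> i \<and> 1 \<le> j}.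
          bracket sA lact ract 1 (pair_cochain (Rs i) (Ss i)) 1 (pair_cochain (Rs j) (Ss j)) us) =
        (\<Sum>i=1..N. bracket sA lact ract 1 (pair_cochain (Rs i) (Ss i))
          1 (pair_cochain (Rs (N + 1 - i)) (Ss (N + 1 - i))) us)"
      by (rule sum.reindex_bij_witness[where i = "\<lambda>i. (i, N + 1 - i)" and j = fst])
        (auto dest!: sym[of "_ + _"])
    then show ?thesis by (simp only: obstruction_def half)
  qed
  have "(\<Sum>i\<le>N+1. bracket sA lact ract 1 (pair_cochain (?R i) (?S i))
       1 (pair_cochain (?R (N + 1 - i)) (?S (N + 1 - i))) [u, v]) =
     ?d [u, v] + ?d [u, v] - (?Ob [u, v] + ?Ob [u, v])" (is "sum ?f _ = _") for u v
  proof -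
    have "sum ?f {..N+1} = ?f 0 + sum ?f {1..N} + ?f (N + 1)"
      by (simp add: atMost_atLeast0 sum.atLeast_Suc_atMost)
    \<comment> \<open>For \<open>i\<close> in \<open>1..N\<close> neither \<open>i\<close> nor
      \<open>N + 1 - i\<close> is \<open>N + 1\<close>, so the updates are invisible.\<close>
    also have "sum ?f {1..N} = - (?Ob [u, v] + ?Ob [u, v])"
      unfolding Ob2 minus_minus by (rule sum.cong) auto
    also have "?f 0 = ?d [u, v]"
      by (simp add: differential_def zero)
    \<comment> \<open>Here the new pair is the first argument of the bracket; symmetry in degrees
      (1,1) moves it to the second, as in the differential.\<close>
    also have "?f (N + 1) = ?d [u, v]"
      using bracket_sym_one_one[of R' S' R S u v] by (simp add: differential_def zero)
    finally show ?thesis by (simp add: algebra_simps)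
  qed
  then have "rota_baxter_coeff (N + 1) ?R ?S \<longleftrightarrow> (\<forall>u v. ?d [u, v] = ?Ob [u, v])"
    using rota_baxter_coeff_iff_bracket[of "N + 1" ?R ?S] lin by (simp add: double_eq_iff)
  \<comment> \<open>Both functions vanish on lists of length other than 2, so agreement on pairs
    suffices.\<close>
  also have "\<dots> \<longleftrightarrow> ?d = ?Ob"
  proof
    assume h: "\<forall>u v. ?d [u, v] = ?Ob [u, v]"
    show "?d = ?Ob"
    proof
      fix us
      show "?d us = ?Ob us"
      proof (cases "length us = 2")
        case True
        then show ?thesis using h by (auto simp: length_Suc_conv numeral_2_eq_2)
      next
        case False
        then show ?thesis
          by (simp add: differential_def obstruction_def bracket_def scale_pair_def prod_eq_iff)
      qed
    qed
  qed simp
  finally show ?thesis .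
qed

section \<open>Coboundaries and the cohomology class\<close>

lemma coboundaries_two:
  "coboundaries sA sM lact ract R S 2 = {differential sA lact ract R S 1 (pair_cochain X Y) | X Y.
      Vector_Spaces.linear sM sA X \<and> Vector_Spaces.linear sM sA Y}"
proof -
  have "cochains sA sM 1 = {pair_cochain X Y | X Y.
      Vector_Spaces.linear sM sA X \<and> Vector_Spaces.linear sM sA Y}"
    by (blast elim: cochain_one_cases intro: pair_cochain_in_cochains)
  then show ?thesis by (auto simp: coboundaries_def)
qed

text \<open>The possible top coefficients of an extension are exactly the 1-cochains whose
  differential is the obstruction.\<close>

lemma extensible_iff_coboundary:
  assumes "deformation sA sM lact ract R S N Rs Ss"
  shows "extensible sA sM lact ract R S N Rs Ss \<longleftrightarrow>
    obstruction sA lact ract N Rs Ss \<in> coboundaries sA sM lact ract R S 2"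
proof -
  have "extensible sA sM lact ract R S N Rs Ss \<longleftrightarrow>
    (\<exists>R' S'. Vector_Spaces.linear sM sA R' \<and> Vector_Spaces.linear sM sA S' \<and>
       differential sA lact ract R S 1 (pair_cochain R' S') = obstruction sA lact ract N Rs Ss)"
    unfolding extensible_def
    using deformation_extend_iff[OF assms] rota_baxter_coeff_extend_iff[OF assms] by blast
  also have "\<dots> \<longleftrightarrow> obstruction sA lact ract N Rs Ss \<in> coboundaries sA sM lact ract R S 2"
    unfolding coboundaries_two mem_Collect_eq by metis
  finally show ?thesis .
qed

lemma differential_one_diff:
  assumes "gen_rota_baxter sA sM lact ract R S"
  shows "differential sA lact ract R S 1 (pair_cochain X Y) -
      differential sA lact ract R S 1 (pair_cochain X' Y') =
    differential sA lact ract R S 1 (pair_cochain (\<lambda>u. X u - X' u) (\<lambda>u. Y u - Y' u))"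
proof
  fix us
  have add: "R (u + v) = R u + R v" "S (u + v) = S u + S v" for u v
    using assms by (simp_all add: gen_rota_baxter_def gen_rota_baxter_on_def linear_map_on_def)
  have diff: "R (u - v) = R u - R v" "S (u - v) = S u - S v" for u v
    using add[of "u - v" v] by simp_all
  show "(differential sA lact ract R S 1 (pair_cochain X Y) -
      differential sA lact ract R S 1 (pair_cochain X' Y')) us =
    differential sA lact ract R S 1 (pair_cochain (\<lambda>u. X u - X' u) (\<lambda>u. Y u - Y' u)) us"
  proof (cases "length us = 2")
    case True
    then obtain u v where "us = [u, v]"
      by (auto simp: length_Suc_conv numeral_2_eq_2)
    then show ?thesis
      unfolding differential_def
      by (simp only: fun_diff_def bracket_one_one)
        (simp add: add diff bilinear_simps algebra_simps)
  next
    case False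
    then show ?thesis by (simp add: differential_def bracket_def)
  qed
qed

text \<open>The class of a non-cocycle is empty, hence different from the class of 0, which contains
  0. So equality of classes also yields that \<open>F\<close> is a cocycle. Conversely, the class of
  every coboundary is the whole set of coboundaries.\<close>

lemma cohomology_class_two_eq_zero_iff:
  assumes rb: "gen_rota_baxter sA sM lact ract R S"
  shows "cohomology_class sA sM lact ract R S 2 F = cohomology_class sA sM lact ract R S 2 0 \<longleftrightarrow>
    F \<in> coboundaries sA sM lact ract R S 2"
    (is "?cls F = _ \<longleftrightarrow> F \<in> ?B")
proof -
  let ?Z = "cocycles sA sM lact ract R S 2"
  have lin: "Vector_Spaces.linear sM sA R" "Vector_Spaces.linear sM sA S"
    using rb by (simp_all add: gen_rota_baxter_def gen_rota_baxter_on_def linear_map_on_def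
        Vector_Spaces.linear_iff M.vector_space_axioms A.vector_space_axioms)
  have diff: "G - H \<in> ?B" if "G \<in> ?B" "H \<in> ?B" for G H
  proof -
    obtain X Y where G: "G = differential sA lact ract R S 1 (pair_cochain X Y)"
      and l: "Vector_Spaces.linear sM sA X" "Vector_Spaces.linear sM sA Y"
      using \<open>G \<in> ?B\<close> unfolding coboundaries_two by blast
    obtain X' Y' where H: "H = differential sA lact ract R S 1 (pair_cochain X' Y')"
      and l': "Vector_Spaces.linear sM sA X'" "Vector_Spaces.linear sM sA Y'"
      using \<open>H \<in> ?B\<close> unfolding coboundaries_two by blast
    have "Vector_Spaces.linear sM sA (\<lambda>u. X u - X' u)" "Vector_Spaces.linear sM sA (\<lambda>u. Y u - Y' u)"
      using l l' by (simp_all add: Vector_Spaces.linear_iff A.scale_right_diff_distrib)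
    then show ?thesis
      unfolding G H differential_one_diff[OF rb] coboundaries_two by blast
  qed
  have BZ: "?B \<subseteq> ?Z"
    unfolding coboundaries_two cocycles_def
    using differential_differential_one[OF rb]
      bracket_one_one_in_cochains[OF lin, folded differential_def] by blast
  have zeroB: "0 \<in> ?B"
  proof -
    have "Vector_Spaces.linear sM sA (\<lambda>u. 0)"
      by (simp add: Vector_Spaces.linear_iff M.vector_space_axioms A.vector_space_axioms)
    then have "differential sA lact ract R S 1 (pair_cochain (\<lambda>u. 0) (\<lambda>u. 0)) \<in> ?B"
      unfolding coboundaries_two by blast
    \<comment> \<open>Zero arises as the difference of a coboundary with itself.\<close>
    from diff[OF this this] show ?thesis by (simp only: diff_self)
  qed
  show ?thesis
  proof
    assume "?cls F = ?cls 0"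
    moreover have "0 \<in> ?cls 0"
      unfolding cohomology_class_def cohomologous_def Image_singleton mem_Collect_eq prod.case
      by (intro conjI subsetD[OF BZ] zeroB diff)
    ultimately have "0 \<in> ?cls F" by simp
    then have "F - 0 \<in> ?B"
      unfolding cohomology_class_def cohomologous_def by blast
    then show "F \<in> ?B" by (simp only: diff_zero)
  next
    assume F: "F \<in> ?B"
    \<comment> \<open>Closure under differences works both ways, since \<open>G\<close> is
      \<open>H - (H - G)\<close>.\<close>
    have *: "H - G \<in> ?B \<longleftrightarrow> G \<in> ?B" if H: "H \<in> ?B" for G H
    proof -
      have "H - (H - G) = G" by (simp add: diff_diff_eq2)
      then show ?thesis using diff[OF H, of "H - G"] diff[OF H, of G] by metis
    qed
    have "?cls H = ?B" if H: "H \<in> ?B" for H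
      unfolding cohomology_class_def cohomologous_def Image_singleton mem_Collect_eq prod.case *[OF H]
      using H BZ by blast
    from this[OF F] this[OF zeroB] show "?cls F = ?cls 0" by (rule trans[OF _ sym])
  qed
qed

end

theorem theorem4p8:
  fixes sA :: "'k::field_char_0 \<Rightarrow> 'a::ring \<Rightarrow> 'a"
    and sM :: "'k \<Rightarrow> 'm::ab_group_add \<Rightarrow> 'm"
    and lact :: "'a \<Rightarrow> 'm \<Rightarrow> 'm"
    and ract :: "'m \<Rightarrow> 'a \<Rightarrow> 'm"
    and R S :: "'m \<Rightarrow> 'a"
    and N :: nat
    and Rs Ss :: "nat \<Rightarrow> 'm \<Rightarrow> 'a"
  assumes "algebra_bimodule sA sM lact ract"
    and "gen_rota_baxter sA sM lact ract R S"
    and "deformation sA sM lact ract R S N Rs Ss"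
  shows "extensible sA sM lact ract R S N Rs Ss \<longleftrightarrow>
    cohomology_class sA sM lact ract R S 2 (obstruction sA lact ract N Rs Ss) =
    cohomology_class sA sM lact ract R S 2 0"
proof -
  interpret algebra_bimodule sA sM lact ract by fact
  show ?thesis
    using extensible_iff_coboundary[OF assms(3)] cohomology_class_two_eq_zero_iff[OF assms(2)]
    by simp
qed

end
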